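(* Let $G$ be a Cartesian graph bundle with fibre $F$ over the base graph $B$, let $F$ be $(p_F,q_F)$-connected and let $B$ be $(p_B,q_B)$-connected (with $p_F,q_F,p_B,q_B\ge 0$ integers). Then: (1) $G$ is $(p_F+p_B,\,q_F+q_B)$-connected; (2) if $q_F>0$ and $q_B>0$, then $G$ is also $(p_F+p_B+1,\,q_F+q_B-1)$-connected.
   Context: All graphs are simple. For a graph $G$, $X_V\subseteq V(G)$ and $X_E\subseteq E(G)$, $G\setminus(X_V\cup X_E)$ denotes the subgraph of $(V(G),E(G)\setminus X_E)$ induced on $V(G)\setminus X_V$. Mixed connectivity: for $p>0$, $G$ is $(p,0)$-connected if $G\setminus X$ is connected for every set $X$ of $p-1$ vertices; for $p\ge 0$ and $q>0$, $G$ is $(p,q)$-connected if $G\setminus(X\cup Y)$ is connected for every set $X$ of $p$ vertices and every set $Y$ of $q-1$ edges. The Cartesian product $F\Box K_2$ has vertex set $V(F)\times V(K_2)$, with $(u_1,v_1)\sim(u_2,v_2)$ iff either $u_1u_2\in E(F)$ and $v_1=v_2$, or $v_1v_2\in E(K_2)$ and $u_1=u_2$. A graph $G$ is a Cartesian graph bundle with fibre $F$ over base graph $B$ if there is a graph map $p:V(G)\cup E(G)\to V(B)\cup E(B)$ sending vertices to vertices and edges to vertices or edges, such that for each $v\in V(B)$ the preimage $p^{-1}(\{v\})$ is isomorphic to $F$, and for each edge $e\in E(B)$ the preimage $p^{-1}(\{e\})$ is isomorphic to $F\Box K_2$.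
   Formalization: Connected graphs are taken to have at least two vertices, F and B must have the vertices and edges to be deleted, and the isomorphism of each edge's preimage (with endpoints) to F□K_2 must respect p; read literally, (1) fails for B=K_1 and for F=P_3, B=K_3. *)

theory Defs
  imports "HOL-Library.Ramsey"
begin

text \<open>
  Simple undirected graphs, possibly infinite; an edge is the two-element set of its endpoints,
  and \<^term>\<open>nsets A k\<close> is the set of all (finite) \<^term>\<open>k\<close>-element subsets of \<^term>\<open>A\<close>.
\<close>

datatype 'a sgraph = SGraph (verts: "'a set") (edges: "'a set set")

definition simple_graph :: "'a sgraph \<Rightarrow> bool" where
  "simple_graph G \<longleftrightarrow> edges G \<subseteq> nsets (verts G) 2"

definition delete :: "'a sgraph \<Rightarrow> 'a set \<Rightarrow> 'a set set \<Rightarrow> 'a sgraph" where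
  "delete G X Y = SGraph (verts G - X) {e \<in> edges G - Y. e \<subseteq> verts G - X}"

text \<open>
  The empty graph and the one-vertex graph count as disconnected, so that the complete graph
  on \<^term>\<open>n\<close> vertices has connectivity \<^term>\<open>n - 1\<close>, as usual.  With a connected
  one-vertex graph, that graph would be (1, 0)-connected, and taking
  it as a base would make every \<^term>\<open>(p, q)\<close>-connected fibre \<^term>\<open>(p + 1, q)\<close>-connected.
\<close>

definition connected_graph :: "'a sgraph \<Rightarrow> bool" where
  "connected_graph G \<longleftrightarrow>
     (\<exists>x\<in>verts G. \<exists>y\<in>verts G. x \<noteq> y) \<and>
     (\<forall>x\<in>verts G. \<forall>y\<in>verts G. (x, y) \<in> {(a, b). {a, b} \<in> edges G}\<^sup>*)"

text \<open>
  The two nonemptiness conditions say that it is possible to remove the stated numbers of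
  vertices and edges at all; otherwise a graph with too few vertices or edges would satisfy
  the condition vacuously.  The notion is not defined for \<^term>\<open>p = 0\<close> and \<^term>\<open>q = 0\<close>, and
  no graph satisfies the predicate in that case.
\<close>

definition mixed_connected :: "'a sgraph \<Rightarrow> nat \<Rightarrow> nat \<Rightarrow> bool" where
  "mixed_connected G p q \<longleftrightarrow>
     (p > 0 \<and> q = 0 \<and>
        nsets (verts G) (p - 1) \<noteq> {} \<and>
        (\<forall>X \<in> nsets (verts G) (p - 1). connected_graph (delete G X {}))) \<or>
     (q > 0 \<and>
        nsets (verts G) p \<noteq> {} \<and> nsets (edges G) (q - 1) \<noteq> {} \<and>
        (\<forall>X \<in> nsets (verts G) p. \<forall>Y \<in> nsets (edges G) (q - 1).
           connected_graph (delete G X Y)))"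

definition cart_prod :: "'a sgraph \<Rightarrow> 'b sgraph \<Rightarrow> ('a \<times> 'b) sgraph" where
  "cart_prod F K = SGraph (verts F \<times> verts K)
     {{(u1, v1), (u2, v2)} | u1 v1 u2 v2.
        u1 \<in> verts F \<and> u2 \<in> verts F \<and> v1 \<in> verts K \<and> v2 \<in> verts K \<and>
        ({u1, u2} \<in> edges F \<and> v1 = v2 \<or> {v1, v2} \<in> edges K \<and> u1 = u2)}"

definition graph_iso :: "('a \<Rightarrow> 'b) \<Rightarrow> 'a sgraph \<Rightarrow> 'b sgraph \<Rightarrow> bool" where
  "graph_iso f G H \<longleftrightarrow> bij_betw f (verts G) (verts H) \<and>
     (\<forall>x\<in>verts G. \<forall>y\<in>verts G. {x, y} \<in> edges G \<longleftrightarrow> {f x, f y} \<in> edges H)"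

text \<open>
  A vertex \<^term>\<open>x\<close> is the element \<^term>\<open>Inl x\<close> of a graph, an edge \<^term>\<open>e\<close> is the element \<^term>\<open>Inr e\<close>.
\<close>

definition elems :: "'a sgraph \<Rightarrow> ('a + 'a set) set" where
  "elems G = verts G <+> edges G"

text \<open>
  A graph map is compatible with incidence: an edge goes to the common image of its endpoints
  (a degenerate edge), or to an edge joining the images of its endpoints.
\<close>

definition graph_map ::
  "('a + 'a set \<Rightarrow> 'b + 'b set) \<Rightarrow> 'a sgraph \<Rightarrow> 'b sgraph \<Rightarrow> bool" where
  "graph_map p G B \<longleftrightarrow>
     p ` elems G \<subseteq> elems B \<and>
     (\<forall>x \<in> verts G. p (Inl x) \<in> Inl ` verts B) \<and>
     (\<forall>e \<in> edges G. (\<forall>w. p (Inr e) = Inl w \<longrightarrow> (\<forall>x\<in>e. p (Inl x) = Inl w)) \<and>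
                      (\<forall>d. p (Inr e) = Inr d \<longrightarrow> (\<lambda>x. p (Inl x)) ` e = Inl ` d))"

definition preimage_graph ::
  "('a + 'a set \<Rightarrow> 'b + 'b set) \<Rightarrow> 'a sgraph \<Rightarrow> 'b sgraph \<Rightarrow> 'a sgraph" where
  "preimage_graph p G H =
     SGraph {x \<in> verts G. p (Inl x) \<in> elems H} {e \<in> edges G. p (Inr e) \<in> elems H}"

definition vertex_graph :: "'a \<Rightarrow> 'a sgraph" where
  "vertex_graph v = SGraph {v} {}"

definition edge_graph :: "'a set \<Rightarrow> 'a sgraph" where
  "edge_graph e = SGraph e {e}"

text \<open>
  The preimage of an edge \<^term>\<open>e\<close> consists of everything lying over \<^term>\<open>e\<close> or its two endpoints, and
  the factor \<^term>\<open>K2\<close> of the product is \<^term>\<open>e\<close> itself with its endpoints.  The isomorphism with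
  the product has to identify the given map with the projection to this factor.
  A mere isomorphism of abstract graphs is not enough: the ladder with rows a1 b1 c1 and
  a2 b2 c2 is a path on three vertices times \<^term>\<open>K2\<close>, and it also splits into the induced paths
  a2 a1 b1 and b2 c2 c1, but the edges between these two are not a matching.
\<close>

definition bundle_map ::
  "('g + 'g set \<Rightarrow> 'b + 'b set) \<Rightarrow> 'g sgraph \<Rightarrow> 'f sgraph \<Rightarrow> 'b sgraph \<Rightarrow> bool" where
  "bundle_map p G F B \<longleftrightarrow>
     graph_map p G B \<and>
     (\<forall>v \<in> verts B. \<exists>\<phi>. graph_iso \<phi> (preimage_graph p G (vertex_graph v)) F) \<and>
     (\<forall>e \<in> edges B. \<exists>\<psi>. let H = preimage_graph p G (edge_graph e) in
        graph_iso \<psi> H (cart_prod F (edge_graph e)) \<and>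
        (\<forall>x \<in> verts H. p (Inl x) = Inl (snd (\<psi> x))))"

definition cartesian_bundle :: "'g sgraph \<Rightarrow> 'f sgraph \<Rightarrow> 'b sgraph \<Rightarrow> bool" where
  "cartesian_bundle G F B \<longleftrightarrow> (\<exists>p. bundle_map p G F B)"

end

theory Submission
  imports Defs
begin

text \<open>
  In terms of the numbers of deleted vertices and edges, all cases reduce to one: if \<open>F\<close> stays connected
  after deleting \<open>p\<close> vertices and \<open>a\<close> edges, and \<open>B\<close> after deleting \<open>r\<close> vertices and \<open>b\<close> edges, then \<open>G\<close>
  stays connected after deleting \<open>p + r + 1\<close> vertices and \<open>a + b\<close> edges; trading a vertex for an edge
  then gives (1) from (2). A count of neighbours shows that no component of what remains of \<open>G\<close> lies
  within one fibre. Hence fibres that lost vertices can be removed one by one, until \<open>r = 0\<close>. There,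
  a fibre meeting both sides of a separation must have lost \<open>p + 1\<close> vertices, so there is at most one
  such fibre, and the edges lying over a cut of \<open>B\<close> are too many to be all deleted.
\<close>

section \<open>Connectivity after deletions\<close>

text \<open>A path from \<open>Q\<close> to its complement has an edge leaving \<open>Q\<close>;
  conversely, no edge leaves the set of vertices reachable from \<open>x\<close>. All later
  arguments use such splits into two sides instead of paths.\<close>

lemma connected_delete_iff:
  "connected_graph (delete G X Y) \<longleftrightarrow>
     (\<exists>x\<in>verts G - X. \<exists>y\<in>verts G - X. x \<noteq> y) \<and>
     (\<forall>Q. Q \<subseteq> verts G - X \<and> Q \<noteq> {} \<and> Q \<noteq> verts G - X \<longrightarrow>
        (\<exists>z\<in>Q. \<exists>w\<in>verts G - X - Q. {z, w} \<in> edges G - Y))"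
    (is "_ \<longleftrightarrow> _ \<and> ?cut")
proof -
  let ?V = "verts G - X"
  let ?r = "{(a, b). {a, b} \<in> edges (delete G X Y)}"
  have "(\<forall>x\<in>?V. \<forall>y\<in>?V. (x, y) \<in> ?r\<^sup>*) \<longleftrightarrow> ?cut"
  proof (intro iffI allI impI ballI)
    fix Q assume conn: "\<forall>x\<in>?V. \<forall>y\<in>?V. (x, y) \<in> ?r\<^sup>*"
      and Q: "Q \<subseteq> ?V \<and> Q \<noteq> {} \<and> Q \<noteq> ?V"
    then obtain x y where xy: "x \<in> Q" "y \<in> ?V" "y \<notin> Q" by blast
    then have "(x, y) \<in> ?r\<^sup>*" using conn Q by blast
    then have "y \<notin> Q \<Longrightarrow> \<exists>z w. z \<in> Q \<and> w \<notin> Q \<and> (z, w) \<in> ?r"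
      using xy(1) by (induction rule: rtrancl_induct) blast+
    then obtain z w where "z \<in> Q" "w \<notin> Q" "(z, w) \<in> ?r" using xy by blast
    then show "\<exists>z\<in>Q. \<exists>w\<in>?V - Q. {z, w} \<in> edges G - Y"
      by (auto simp: delete_def)
  next
    fix x y assume cut: ?cut and x: "x \<in> ?V" and y: "y \<in> ?V"
    let ?Q = "{w \<in> ?V. (x, w) \<in> ?r\<^sup>*}"
    have "\<not> (\<exists>z\<in>?Q. \<exists>w\<in>?V - ?Q. {z, w} \<in> edges G - Y)"
    proof
      assume "\<exists>z\<in>?Q. \<exists>w\<in>?V - ?Q. {z, w} \<in> edges G - Y"
      then obtain z w where "z \<in> ?Q" "w \<in> ?V" "w \<notin> ?Q" "{z, w} \<in> edges G - Y" by blast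
      moreover from this have "(z, w) \<in> ?r" by (auto simp: delete_def)
      ultimately show False by (auto dest: rtrancl_into_rtrancl)
    qed
    moreover have "x \<in> ?Q" using x by simp
    ultimately have "?Q = ?V" using cut[rule_format, of ?Q] by blast
    then show "(x, y) \<in> ?r\<^sup>*" using y by blast
  qed
  then show ?thesis
    by (simp add: connected_graph_def delete_def)
qed

text \<open>This is \<open>(p, q + 1)\<close>-connectivity, and \<open>(p + 1, 0)\<close>-connectivity in the case \<open>q = 0\<close>.\<close>

definition resilient :: "'a sgraph \<Rightarrow> nat \<Rightarrow> nat \<Rightarrow> bool" where
  "resilient G p q \<longleftrightarrow> (\<forall>X Y. finite X \<and> card X \<le> p \<and> finite Y \<and> card Y \<le> q \<longrightarrow>
     connected_graph (delete G X Y))"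

lemma resilientD:
  assumes "resilient G p q" "finite X" "card X \<le> p" "finite Y" "card Y \<le> q"
  shows "connected_graph (delete G X Y)"
  using assms unfolding resilient_def by blast

lemma resilient_mono: "resilient G p q \<Longrightarrow> p' \<le> p \<Longrightarrow> q' \<le> q \<Longrightarrow> resilient G p' q'"
  by (auto simp: resilient_def)

lemma connected_delete_crossing:
  assumes "connected_graph (delete G X Y)" "Q \<union> R = verts G - X" "Q \<inter> R = {}" "Q \<noteq> {}" "R \<noteq> {}"
  obtains z w where "z \<in> Q" "w \<in> R" "{z, w} \<in> edges G" "{z, w} \<notin> Y"
proof -
  have "Q \<subseteq> verts G - X \<and> Q \<noteq> {} \<and> Q \<noteq> verts G - X" "verts G - X - Q = R"
    using assms by blast+
  then show ?thesis using assms(1) that unfolding connected_delete_iff by (metis DiffE)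
qed

lemma connected_delete_two_verts:
  assumes "connected_graph (delete G X Y)"
  shows "\<not> verts G - X \<subseteq> {x}"
  using assms unfolding connected_delete_iff by blast

lemma connected_deleteI:
  assumes "\<And>x. \<not> verts G - X \<subseteq> {x}"
    and "\<And>Q R. Q \<union> R = verts G - X \<Longrightarrow> Q \<inter> R = {} \<Longrightarrow> Q \<noteq> {} \<Longrightarrow> R \<noteq> {} \<Longrightarrow>
           \<exists>z\<in>Q. \<exists>w\<in>R. {z, w} \<in> edges G \<and> {z, w} \<notin> Y"
  shows "connected_graph (delete G X Y)"
  unfolding connected_delete_iff
proof (intro conjI allI impI)
  obtain x where x: "x \<in> verts G - X" using assms(1) by blast
  then show "\<exists>x\<in>verts G - X. \<exists>y\<in>verts G - X. x \<noteq> y" using assms(1)[of x] by blast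
next
  fix Q assume "Q \<subseteq> verts G - X \<and> Q \<noteq> {} \<and> Q \<noteq> verts G - X"
  then have "\<exists>z\<in>Q. \<exists>w\<in>verts G - X - Q. {z, w} \<in> edges G \<and> {z, w} \<notin> Y"
    by (intro assms(2)) auto
  then show "\<exists>z\<in>Q. \<exists>w\<in>verts G - X - Q. {z, w} \<in> edges G - Y" by auto
qed

text \<open>An edge of \<open>Y\<close> can be replaced by either of its endpoints. If both replacements leave a connected
  graph but the edge itself does not, its endpoints are the only remaining vertices.\<close>

lemma resilient_trade:
  fixes G :: "'a sgraph"
  assumes sg: "simple_graph G" and res: "resilient G (Suc p) q"
  shows "resilient G p (Suc q)"
  unfolding resilient_def
proof (intro allI impI, elim conjE)
  fix X :: "'a set" and Y :: "'a set set"
  assume X: "finite X" "card X \<le> p" and Y: "finite Y" "card Y \<le> Suc q"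
  have ins: "connected_graph (delete G (insert u X) (Y - {e}))" if "e \<in> Y" for u e
    using that X Y by (intro resilientD[OF res]) (auto simp: card_insert_if)
  show "connected_graph (delete G X Y)"
  proof (cases "\<exists>e\<in>Y. e \<in> edges G")
    case False
    have "connected_graph (delete G X {})"
      using X by (intro resilientD[OF res]) auto
    moreover have "delete G X Y = delete G X {}" using False by (auto simp: delete_def)
    ultimately show ?thesis by simp
  next
    case True
    then obtain e where e: "e \<in> Y" "e \<in> edges G" by blast
    then have "e \<subseteq> verts G" "card e = 2" using sg by (auto simp: simple_graph_def nsets_def)
    then obtain u v where uv: "e = {u, v}" "u \<noteq> v" by (auto simp: card_2_iff)
    have two: "\<not> verts G - insert x X \<subseteq> {y}" for x y
      using connected_delete_two_verts[OF ins[OF e(1)]] .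
    show ?thesis
    proof (rule connected_deleteI)
      fix x show "\<not> verts G - X \<subseteq> {x}" using two by blast
    next
      fix Q R assume QR: "Q \<union> R = verts G - X" "Q \<inter> R = {}" "Q \<noteq> {}" "R \<noteq> {}"
      show "\<exists>z\<in>Q. \<exists>w\<in>R. {z, w} \<in> edges G \<and> {z, w} \<notin> Y"
      proof (rule ccontr)
        assume no: "\<not> ?thesis"
        \<comment> \<open>Once an endpoint \<open>x\<close> of \<open>e\<close> is gone,
          \<open>e\<close> cannot join the sides, so an edge crossing outside \<open>Y - {e}\<close>
          also lies outside \<open>Y\<close>.\<close>
        have *: "Q - {x} = {} \<or> R - {x} = {}" if "x \<in> e" for x
        proof (rule ccontr)
          assume ne: "\<not> ?thesis"
          obtain z w where "z \<in> Q - {x}" "w \<in> R - {x}" "{z, w} \<in> edges G" "{z, w} \<notin> Y - {e}"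
            by (rule connected_delete_crossing[OF ins[OF e(1), of x], of "Q - {x}" "R - {x}"])
               (use QR ne in auto)
          with no that show False by blast
        qed
        have "verts G - insert u X \<subseteq> {v}" using *[of u] *[of v] QR uv by blast
        with two show False by blast
      qed
    qed
  qed
qed

lemma resilient_trade_add:
  assumes "simple_graph G" "resilient G (p + i) q"
  shows "resilient G p (q + i)"
  using assms(2)
proof (induction i arbitrary: p)
  case (Suc i)
  then have "resilient G (Suc p) (q + i)" by simp
  then show ?case using resilient_trade[OF assms(1)] by simp
qed simp

section \<open>Mixed connectivity as resilience; degrees, cuts and transfer\<close>

lemma nsets_extend:
  assumes "nsets A n \<noteq> {}" "finite N" "N \<subseteq> A" "card N \<le> n"
  obtains M where "M \<in> nsets A n" "N \<subseteq> M"
proof -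
  obtain K where K: "K \<subseteq> A" "finite K" "card K = n" using assms(1) by (auto simp: nsets_def)
  then have "card K \<le> card (N \<union> K)" using assms(2) by (intro card_mono) auto
  then obtain M where "N \<subseteq> M" "M \<subseteq> N \<union> K" "card M = n"
    using exists_subset_between[of N n "N \<union> K"] assms K by auto
  moreover from this have "M \<in> nsets A n"
    using assms(2,3) K finite_subset[of M "N \<union> K"] by (auto simp: nsets_def)
  ultimately show ?thesis using that by blast
qed

text \<open>If deleting any \<open>n + 1\<close> vertices leaves a connected graph with at least two vertices, then both
  sides of a separation after deleting \<open>n\<close> vertices would be singletons, leaving too few vertices.\<close>

lemma connected_delete_fewer:
  assumes ne: "nsets (verts G) (Suc n) \<noteq> {}"
    and conn: "\<And>X. X \<in> nsets (verts G) (Suc n) \<Longrightarrow> connected_graph (delete G X Y)"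
    and X: "X \<in> nsets (verts G) n"
  shows "connected_graph (delete G X Y)"
proof (rule connected_deleteI)
  have ins: "connected_graph (delete G (insert v X) Y)" if "v \<in> verts G - X" for v
    using that X by (intro conn) (auto simp: nsets_def)
  {
    fix x
    obtain M where M: "M \<in> nsets (verts G) (Suc n)" "X \<subseteq> M"
      by (rule nsets_extend[OF ne]) (use X in \<open>auto simp: nsets_def\<close>)
    then show "\<not> verts G - X \<subseteq> {x}"
      using connected_delete_two_verts[OF conn[OF M(1)]] by blast
  }
  fix Q R assume QR: "Q \<union> R = verts G - X" "Q \<inter> R = {}" "Q \<noteq> {}" "R \<noteq> {}"
  show "\<exists>z\<in>Q. \<exists>w\<in>R. {z, w} \<in> edges G \<and> {z, w} \<notin> Y"
  proof (rule ccontr)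
    assume no: "\<not> ?thesis"
    have *: "Q - {x} = {} \<or> R - {x} = {}" if x: "x \<in> verts G - X" for x
    proof (rule ccontr)
      assume ne: "\<not> ?thesis"
      obtain z w where "z \<in> Q - {x}" "w \<in> R - {x}" "{z, w} \<in> edges G" "{z, w} \<notin> Y"
        by (rule connected_delete_crossing[OF ins[OF x], of "Q - {x}" "R - {x}"])
           (use QR ne in auto)
      with no show False by blast
    qed
    obtain u v where uv: "u \<in> Q" "v \<in> R" using QR by blast
    then have V: "u \<in> verts G - X" "v \<in> verts G - X" using QR by blast+
    have "verts G - insert u X \<subseteq> {v}" using *[OF V(1)] *[OF V(2)] QR uv by blast
    with connected_delete_two_verts[OF ins[OF V(1)]] show False by blast
  qed
qed

text \<open>Deleting more edges only makes connectedness harder, so \<open>Y\<close> is padded to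
  \<open>q\<close> edges. Padding \<open>X\<close> could swallow a whole side, so the number of
  deleted vertices is instead lowered from \<open>p\<close> one at a time.\<close>

lemma resilient_if_exact:
  fixes G :: "'a sgraph"
  assumes neV: "nsets (verts G) p \<noteq> {}" and neE: "nsets (edges G) q \<noteq> {}"
    and conn: "\<And>X Y. X \<in> nsets (verts G) p \<Longrightarrow> Y \<in> nsets (edges G) q \<Longrightarrow>
                connected_graph (delete G X Y)"
  shows "resilient G p q"
  unfolding resilient_def
proof (intro allI impI, elim conjE)
  fix X :: "'a set" and Y :: "'a set set"
  assume X: "finite X" "card X \<le> p" and Y: "finite Y" "card Y \<le> q"
  have "card (Y \<inter> edges G) \<le> q" using Y by (meson card_mono inf_le1 order_trans)
  then obtain Y' where Y': "Y' \<in> nsets (edges G) q" "Y \<inter> edges G \<subseteq> Y'"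
    using nsets_extend[OF neE, of "Y \<inter> edges G"] Y by auto
  have less: "nsets (verts G) n \<noteq> {} \<and> (\<forall>X \<in> nsets (verts G) n. connected_graph (delete G X Y'))"
    if "n \<le> p" for n
    using that
  proof (induction n rule: inc_induct)
    case base then show ?case using neV conn Y' by blast
  next
    case (step n)
    obtain M where "M \<subseteq> verts G" "finite M" "card M = Suc n" using step.IH by (auto simp: nsets_def)
    then obtain M' where "M' \<subseteq> M" "card M' = n" using obtain_subset_with_card_n[of n M] by auto
    then have "M' \<in> nsets (verts G) n"
      using \<open>M \<subseteq> verts G\<close> \<open>finite M\<close> by (auto simp: nsets_def intro: finite_subset)
    then show ?case using connected_delete_fewer[of G n Y'] step.IH by blast
  qed
  have "card (X \<inter> verts G) \<le> p" using X by (meson card_mono inf_le1 order_trans)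
  then have c: "connected_graph (delete G (X \<inter> verts G) Y')"
    using less[of "card (X \<inter> verts G)"] X by (auto simp: nsets_def)
  have V: "verts G - (X \<inter> verts G) = verts G - X" by blast
  show "connected_graph (delete G X Y)"
  proof (rule connected_deleteI)
    show "\<not> verts G - X \<subseteq> {x}" for x using connected_delete_two_verts[OF c] V by simp
    fix Q R assume "Q \<union> R = verts G - X" "Q \<inter> R = {}" "Q \<noteq> {}" "R \<noteq> {}"
    then obtain z w where "z \<in> Q" "w \<in> R" "{z, w} \<in> edges G" "{z, w} \<notin> Y'"
      by (rule connected_delete_crossing[OF c, unfolded V])
    then show "\<exists>z\<in>Q. \<exists>w\<in>R. {z, w} \<in> edges G \<and> {z, w} \<notin> Y" using Y' by blast
  qed
qed

lemma subset_with_card: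
  assumes "\<not> (finite A \<and> card A < n)"
  obtains N where "N \<subseteq> A" "finite N" "card N = n"
proof (cases "finite A")
  case True
  then have "n \<le> card A" using assms by simp
  then show ?thesis by (rule obtain_subset_with_card_n) (use that in blast)
next
  case False
  then obtain N where "finite N" "card N = n" "N \<subseteq> A"
    using infinite_arbitrarily_large by metis
  then show ?thesis using that by blast
qed

lemma nsets_nonempty: "\<not> (finite A \<and> card A < n) \<Longrightarrow> nsets A n \<noteq> {}"
  by (erule subset_with_card) (auto simp: nsets_def)

text \<open>Otherwise all vertices, or all edges, could be deleted. This makes the nonemptiness
  conditions of \<open>mixed_connected\<close> automatic.\<close>

lemma resilient_nsets:
  fixes G :: "'c sgraph"
  assumes "resilient G p q"
  shows "nsets (verts G) p \<noteq> {}" "nsets (edges G) q \<noteq> {}"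
proof -
  show "nsets (verts G) p \<noteq> {}"
  proof (rule nsets_nonempty, safe)
    assume "finite (verts G)" "card (verts G) < p"
    then have "connected_graph (delete G (verts G) {})" by (intro resilientD[OF assms]) auto
    then show False by (simp add: connected_delete_iff)
  qed
  show "nsets (edges G) q \<noteq> {}"
  proof (rule nsets_nonempty, safe)
    assume "finite (edges G)" "card (edges G) < q"
    then have c: "connected_graph (delete G {} (edges G))" by (intro resilientD[OF assms]) auto
    obtain x where "x \<in> verts G" using connected_delete_two_verts[OF c] by auto
    with connected_delete_two_verts[OF c, of x]
    have "{x} \<union> (verts G - {x}) = verts G - {}" "verts G - {x} \<noteq> {}" by auto
    then show False using connected_delete_crossing[OF c, of "{x}" "verts G - {x}"] by blast
  qed
qed

lemma mixed_connected_iff_resilient: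
  "mixed_connected G p q \<longleftrightarrow> (if q = 0 then p > 0 \<and> resilient G (p - 1) 0 else resilient G p (q - 1))"
proof -
  have *: "resilient G p q \<longleftrightarrow> nsets (verts G) p \<noteq> {} \<and> nsets (edges G) q \<noteq> {} \<and>
        (\<forall>X \<in> nsets (verts G) p. \<forall>Y \<in> nsets (edges G) q. connected_graph (delete G X Y))" for p q
  proof
    assume "resilient G p q"
    then show "nsets (verts G) p \<noteq> {} \<and> nsets (edges G) q \<noteq> {} \<and>
        (\<forall>X \<in> nsets (verts G) p. \<forall>Y \<in> nsets (edges G) q. connected_graph (delete G X Y))"
      using resilient_nsets[of G p q] by (auto simp: nsets_def intro: resilientD)
  qed (use resilient_if_exact[of G p q] in blast)
  show ?thesis unfolding mixed_connected_def * by auto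
qed

text \<open>With at most \<open>p + q\<close> neighbours, \<open>v\<close> could be isolated by
  deleting up to \<open>p\<close> of them and the edges to the others. A finite \<open>N\<close> is
  selected because the neighbourhood may be infinite.\<close>

lemma resilient_degree:
  assumes "simple_graph G" and res: "resilient G p q" and v: "v \<in> verts G"
  obtains N where "finite N" "card N = p + q + 1" "N \<subseteq> verts G" "v \<notin> N" "\<And>u. u \<in> N \<Longrightarrow> {v, u} \<in> edges G"
proof -
  let ?N = "{u \<in> verts G. {v, u} \<in> edges G}"
  have "v \<notin> ?N" using assms(1) by (auto simp: simple_graph_def nsets_def)
  have "\<not> (finite ?N \<and> card ?N \<le> p + q)"
  proof (safe)
    assume fin: "finite ?N" and card: "card ?N \<le> p + q"
    obtain X where X: "X \<subseteq> ?N" "card X = min p (card ?N)" "finite X"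
      using obtain_subset_with_card_n[of "min p (card ?N)" ?N] by auto
    let ?Y = "(\<lambda>u. {v, u}) ` (?N - X)"
    have "card ?Y \<le> card (?N - X)" using fin by (intro card_image_le) auto
    also have "\<dots> \<le> q" using X fin card by (simp add: card_Diff_subset)
    finally have c: "connected_graph (delete G X ?Y)"
      using X fin by (intro resilientD[OF res]) auto
    obtain z w where "z \<in> {v}" "w \<in> verts G - X - {v}" "{z, w} \<in> edges G" "{z, w} \<notin> ?Y"
      by (rule connected_delete_crossing[OF c, of "{v}" "verts G - X - {v}"])
         (use X v \<open>v \<notin> ?N\<close> connected_delete_two_verts[OF c, of v] in auto)
    then show False by auto
  qed
  then have "\<not> (finite ?N \<and> card ?N < p + q + 1)" by auto
  then obtain N where "N \<subseteq> ?N" "finite N" "card N = p + q + 1"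
    by (rule subset_with_card)
  then show ?thesis using that \<open>v \<notin> ?N\<close> by blast
qed

text \<open>If at most \<open>q\<close> edges left \<open>S\<close>, all of them could be deleted.
  Again a finite part is selected, since the cut may be infinite.\<close>

lemma resilient_cut:
  assumes res: "resilient G 0 q" and S: "S \<subseteq> verts G" "S \<noteq> {}" "S \<noteq> verts G"
  obtains D where "finite D" "card D = q + 1" "D \<subseteq> edges G"
    "\<And>e. e \<in> D \<Longrightarrow> \<exists>u\<in>S. \<exists>w\<in>verts G - S. e = {u, w}"
proof -
  let ?D = "{e \<in> edges G. \<exists>u\<in>S. \<exists>w\<in>verts G - S. e = {u, w}}"
  have "\<not> (finite ?D \<and> card ?D \<le> q)"
  proof
    assume "finite ?D \<and> card ?D \<le> q"
    then have c: "connected_graph (delete G {} ?D)" by (intro resilientD[OF res]) auto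
    obtain z w where "z \<in> S" "w \<in> verts G - S" "{z, w} \<in> edges G" "{z, w} \<notin> ?D"
      by (rule connected_delete_crossing[OF c, of S "verts G - S"]) (use S in auto)
    then show False by auto
  qed
  then have "\<not> (finite ?D \<and> card ?D < q + 1)" by auto
  then obtain D where "D \<subseteq> ?D" "finite D" "card D = q + 1"
    by (rule subset_with_card)
  then show ?thesis using that by blast
qed

lemma resilient_delete_vertex:
  fixes G :: "'a sgraph"
  assumes "resilient G (Suc p) q"
  shows "resilient (delete G {v} {}) p q"
  unfolding resilient_def
proof (intro allI impI, elim conjE)
  fix X :: "'a set" and Y :: "'a set set"
  assume "finite X" "card X \<le> p" "finite Y" "card Y \<le> q"
  then have "connected_graph (delete G (insert v X) Y)"
    by (intro resilientD[OF assms]) (auto simp: card_insert_if)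
  moreover have "delete (delete G {v} {}) X Y = delete G (insert v X) Y"
    by (auto simp: delete_def)
  ultimately show "connected_graph (delete (delete G {v} {}) X Y)" by simp
qed

text \<open>Deleted sets are pushed forward along \<open>f\<close>, and a crossing edge of
  \<open>F\<close> is pulled back. Further edges of \<open>H\<close> do no harm.\<close>

lemma resilient_transfer:
  fixes H :: "'h sgraph"
  assumes res: "resilient F p q" and f: "bij_betw f (verts H) (verts F)"
    and edges: "\<And>x y. x \<in> verts H \<Longrightarrow> y \<in> verts H \<Longrightarrow> {f x, f y} \<in> edges F \<Longrightarrow> {x, y} \<in> edges H"
  shows "resilient H p q"
  unfolding resilient_def
proof (intro allI impI, elim conjE)
  fix X :: "'h set" and Y :: "'h set set"
  assume X: "finite X" "card X \<le> p" and Y: "finite Y" "card Y \<le> q"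
  let ?X = "f ` (X \<inter> verts H)" and ?Y = "(`) f ` Y"
  have "card ?X \<le> card (X \<inter> verts H)" "card (X \<inter> verts H) \<le> card X" "card ?Y \<le> card Y"
    using X Y by (auto intro: card_image_le card_mono)
  then have c: "connected_graph (delete F ?X ?Y)"
    using X Y by (intro resilientD[OF res]) auto
  have inj: "inj_on f (verts H)" and img: "f ` verts H = verts F"
    using f by (auto simp: bij_betw_def)
  have V: "f ` (verts H - X) = verts F - ?X"
    using inj_on_image_set_diff[OF inj, of "verts H" "X \<inter> verts H"] img
    by (simp add: Diff_Int)
  show "connected_graph (delete H X Y)"
  proof (rule connected_deleteI)
    show "\<not> verts H - X \<subseteq> {x}" for x
      using connected_delete_two_verts[OF c, of "f x"] by (auto simp flip: V)
    fix Q R assume QR: "Q \<union> R = verts H - X" "Q \<inter> R = {}" "Q \<noteq> {}" "R \<noteq> {}"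
    then have sub: "Q \<subseteq> verts H" "R \<subseteq> verts H" by blast+
    obtain z w where zw: "z \<in> f ` Q" "w \<in> f ` R" "{z, w} \<in> edges F" "{z, w} \<notin> ?Y"
    proof (rule connected_delete_crossing[OF c, of "f ` Q" "f ` R"])
      show "f ` Q \<union> f ` R = verts F - ?X" using QR V by (metis image_Un)
      show "f ` Q \<inter> f ` R = {}" using inj_on_image_Int[OF inj sub] QR by simp
    qed (use QR in auto)
    then obtain z' w' where "z' \<in> Q" "w' \<in> R" "z = f z'" "w = f w'" by blast
    moreover have "{z', w'} \<notin> Y"
    proof
      assume "{z', w'} \<in> Y"
      then have "f ` {z', w'} \<in> ?Y" by blast
      with zw calculation show False by simp
    qed
    moreover have "{z', w'} \<in> edges H" using calculation zw edges sub by blast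
    ultimately show "\<exists>z\<in>Q. \<exists>w\<in>R. {z, w} \<in> edges H \<and> {z, w} \<notin> Y" by blast
  qed
qed

section \<open>Separations of a fibred graph\<close>

locale fibration =
  fixes E :: "'g set set" and fib :: "'b \<Rightarrow> 'g set" and \<pi> :: "'g \<Rightarrow> 'b"
    and B :: "'b sgraph" and p a :: nat
  assumes card_edge: "e \<in> E \<Longrightarrow> card e = 2"
    and simple_base: "simple_graph B"
    and proj_fib: "v \<in> verts B \<Longrightarrow> z \<in> fib v \<Longrightarrow> \<pi> z = v"
    and resilient_fib: "v \<in> verts B \<Longrightarrow> resilient (SGraph (fib v) {e \<in> E. e \<subseteq> fib v}) p a"
    and matching: "{u, v} \<in> edges B \<Longrightarrow>
      \<exists>m. inj_on m (fib u) \<and> m ` fib u \<subseteq> fib v \<and> (\<forall>z\<in>fib u. {z, m z} \<in> E)"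
begin

definition total :: "'g set" where
  "total = (\<Union>v\<in>verts B. fib v)"

lemma simple_fib: "simple_graph (SGraph (fib v) {e \<in> E. e \<subseteq> fib v})"
  using card_edge by (auto simp: simple_graph_def nsets_def intro: card_ge_0_finite)

lemma edge_base: "{u, v} \<in> edges B \<Longrightarrow> u \<in> verts B \<and> v \<in> verts B \<and> u \<noteq> v"
  using simple_base by (auto simp: simple_graph_def nsets_def)

lemma fib_disjoint:
  "u \<in> verts B \<Longrightarrow> v \<in> verts B \<Longrightarrow> u \<noteq> v \<Longrightarrow> fib u \<inter> fib v = {}"
  using proj_fib by blast

lemma fib_degree:
  assumes "v \<in> verts B" "z \<in> fib v"
  obtains N where "finite N" "card N = p + a + 1" "N \<subseteq> fib v" "z \<notin> N" "\<And>w. w \<in> N \<Longrightarrow> {z, w} \<in> E"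
  by (rule resilient_degree[OF simple_fib resilient_fib[OF assms(1)], of z]) (use assms in auto)

lemma card_fib:
  assumes "v \<in> verts B" "finite (fib v)"
  shows "p + a + 2 \<le> card (fib v)"
proof -
  obtain z where z: "z \<in> fib v"
    using connected_delete_two_verts[OF resilientD[OF resilient_fib[OF assms(1)], of "{}" "{}"]] by auto
  obtain N where N: "finite N" "card N = p + a + 1" "N \<subseteq> fib v" "z \<notin> N"
    by (rule fib_degree[OF assms(1) z])
  then have "card (insert z N) \<le> card (fib v)" using z assms by (intro card_mono) auto
  then show ?thesis using N by simp
qed

end

text \<open>Neither side is assumed nonempty, since the aim is to show that one of them is
  empty.\<close>

locale separated_fibration = fibration E fib \<pi> B p a
  for E :: "'g set set" and fib :: "'b \<Rightarrow> 'g set" and \<pi> :: "'g \<Rightarrow> 'b"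
    and B :: "'b sgraph" and p a :: nat +
  fixes X :: "'g set" and Y :: "'g set set" and Q R :: "'g set"
  assumes finite_X: "finite X" and finite_Y: "finite Y"
    and union: "Q \<union> R = total - X" and disj: "Q \<inter> R = {}"
    and closed: "z \<in> Q \<Longrightarrow> w \<in> R \<Longrightarrow> {z, w} \<in> E \<Longrightarrow> {z, w} \<in> Y"
begin

text \<open>Interpreted as \<open>flip\<close>, this yields the counts with the two sides exchanged;
  \<open>lost_verts\<close> and \<open>lost_edges\<close> do not involve the sides and stay the
  same.\<close>

lemma flipped: "separated_fibration E fib \<pi> B p a X Y R Q"
  using finite_X finite_Y union disj closed
  by unfold_locales (auto, metis insert_commute)

section \<open>Counting deletions over vertices and edges of the base\<close>

definition lost_verts :: "'b \<Rightarrow> nat" where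
  "lost_verts v = card (X \<inter> fib v)"

text \<open>\<open>lost_edges {v}\<close> counts the deleted edges inside the fibre of \<open>v\<close>, and \<open>lost_edges {u, v}\<close> those
  lying over the base edge \<open>{u, v}\<close>.\<close>

definition lost_edges :: "'b set \<Rightarrow> nat" where
  "lost_edges D = card {f \<in> Y. \<pi> ` f = D}"

lemma fib_split: "v \<in> verts B \<Longrightarrow> fib v - X = (Q \<inter> fib v) \<union> (R \<inter> fib v)"
  using union by (auto simp: total_def)

lemma sum_lost_verts:
  assumes "finite N" "N \<subseteq> verts B"
  shows "(\<Sum>v\<in>N. lost_verts v) \<le> card X"
proof -
  have "(\<Sum>v\<in>N. lost_verts v) = card (\<Union>v\<in>N. X \<inter> fib v)"
    unfolding lost_verts_def using assms finite_X fib_disjoint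
    by (intro card_UN_disjoint[symmetric]) blast+
  also have "\<dots> \<le> card X" using finite_X by (intro card_mono) auto
  finally show ?thesis .
qed

lemma sum_lost_edges:
  assumes "finite N"
  shows "(\<Sum>D\<in>N. lost_edges D) \<le> card Y"
proof -
  have "(\<Sum>D\<in>N. lost_edges D) = card (\<Union>D\<in>N. {f \<in> Y. \<pi> ` f = D})"
    unfolding lost_edges_def using assms finite_Y
    by (intro card_UN_disjoint[symmetric]) auto
  also have "\<dots> \<le> card Y" using finite_Y by (intro card_mono) auto
  finally show ?thesis .
qed

text \<open>Fibres are disjoint, and the singletons and pairs coming from a star in the base are all
  different, so no deleted element is counted twice.\<close>

lemma star_sum:
  assumes "finite N" "N \<subseteq> verts B" "v \<in> verts B" "v \<notin> N"
  shows "lost_verts v + lost_edges {v} + (\<Sum>u\<in>N. lost_verts u + lost_edges {u} + lost_edges {v, u}) \<le> card X + card Y"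
proof -
  have 1: "lost_verts v + (\<Sum>u\<in>N. lost_verts u) \<le> card X"
    using sum_lost_verts[of "insert v N"] assms by simp
  let ?A = "(\<lambda>u. {u}) ` insert v N" and ?C = "(\<lambda>u. {v, u}) ` N"
  have "?A \<inter> ?C = {}" using assms by (auto simp: doubleton_eq_iff)
  then have "sum lost_edges ?A + sum lost_edges ?C = sum lost_edges (?A \<union> ?C)"
    using assms by (intro sum.union_disjoint[symmetric]) auto
  also have "\<dots> \<le> card Y" using assms by (intro sum_lost_edges) auto
  also have "sum lost_edges ?A = lost_edges {v} + (\<Sum>u\<in>N. lost_edges {u})"
    using assms by (subst sum.reindex) (auto simp: inj_on_def)
  also have "sum lost_edges ?C = (\<Sum>u\<in>N. lost_edges {v, u})"
    using assms by (subst sum.reindex) (auto simp: inj_on_def doubleton_eq_iff)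
  finally show ?thesis using 1 by (simp add: sum.distrib)
qed

text \<open>The matching partner in \<open>fib u\<close> of a vertex of \<open>K\<close> is not in
  \<open>Q\<close>: either it is deleted, or it lies in \<open>R\<close> and the matching edge is
  deleted. Distinct vertices yield distinct deletions. Finiteness is part of the conclusion because
  fibres may be infinite.\<close>

lemma matched_count:
  assumes uv: "{u, v} \<in> edges B" and K: "K \<subseteq> Q \<inter> fib v" and u: "Q \<inter> fib u = {}"
  shows "finite K" "card K \<le> lost_verts u + lost_edges {v, u}"
proof -
  have "{v, u} \<in> edges B" using uv by (simp add: insert_commute)
  then obtain m where m: "inj_on m (fib v)" "m ` fib v \<subseteq> fib u" "\<forall>z\<in>fib v. {z, m z} \<in> E"
    using matching by blast
  have V: "u \<in> verts B" "v \<in> verts B" "u \<noteq> v" using edge_base[OF uv] by auto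
  let ?K1 = "{z \<in> K. m z \<in> X}" and ?K2 = "{z \<in> K. {z, m z} \<in> Y}"
  let ?Y = "{f \<in> Y. \<pi> ` f = {v, u}}"
  have proj: "\<pi> z = v" "\<pi> (m z) = u" if "z \<in> K" for z
    using that K m(2) proj_fib V by blast+
  have K12: "K = ?K1 \<union> ?K2"
  proof
    show "K \<subseteq> ?K1 \<union> ?K2"
    proof
      fix z assume z: "z \<in> K"
      then have "m z \<in> fib u" using K m(2) by blast
      then have "m z \<in> X \<or> m z \<in> R" using union u V by (auto simp: total_def)
      then show "z \<in> ?K1 \<union> ?K2" using closed[of z "m z"] z K m(3) by blast
    qed
  qed auto
  have inj1: "inj_on m ?K1" and img1: "m ` ?K1 \<subseteq> X \<inter> fib u"
    using m K by (blast intro: inj_on_subset)+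
  have inj2: "inj_on (\<lambda>z. {z, m z}) ?K2"
  proof (rule inj_onI)
    fix z z' assume z: "z \<in> ?K2" "z' \<in> ?K2" and eq: "{z, m z} = {z', m z'}"
    have "z \<noteq> m z'" using proj[of z] proj[of z'] z V by auto
    with eq show "z = z'" by (auto simp: doubleton_eq_iff)
  qed
  have img2: "(\<lambda>z. {z, m z}) ` ?K2 \<subseteq> ?Y" using proj by auto
  have fin: "finite (X \<inter> fib u)" "finite ?Y" using finite_X finite_Y by auto
  have "finite ?K1" "finite ?K2"
    using inj_on_finite[OF inj1 img1 fin(1)] inj_on_finite[OF inj2 img2 fin(2)] .
  then show "finite K" by (subst K12) blast
  have "card K \<le> card ?K1 + card ?K2" by (subst K12) (rule card_Un_le)
  also have "\<dots> \<le> lost_verts u + lost_edges {v, u}"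
    unfolding lost_verts_def lost_edges_def
    by (intro add_mono card_inj_on_le[OF inj1 img1 fin(1)] card_inj_on_le[OF inj2 img2 fin(2)])
  finally show "card K \<le> lost_verts u + lost_edges {v, u}" .
qed

text \<open>Each of the \<open>p + a + 1\<close> chosen neighbours of \<open>z\<close> in the fibre
  is in \<open>Q\<close>, is deleted, or is joined to \<open>z\<close> by a deleted edge. Counting
  \<open>z\<close> itself adds one.\<close>

lemma fib_boundary:
  assumes v: "v \<in> verts B" and z: "z \<in> Q \<inter> fib v" and fin: "finite (Q \<inter> fib v)"
  shows "p + a + 2 \<le> card (Q \<inter> fib v) + lost_verts v + lost_edges {v}"
proof -
  obtain N where N: "finite N" "card N = p + a + 1" "N \<subseteq> fib v" "z \<notin> N" "\<And>w. w \<in> N \<Longrightarrow> {z, w} \<in> E"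
    using fib_degree[OF v, of z] z by auto
  let ?K = "Q \<inter> fib v - {z}" and ?N = "{w \<in> N. {z, w} \<in> Y}"
  have "N \<subseteq> ?K \<union> (X \<inter> fib v) \<union> ?N"
  proof
    fix w assume w: "w \<in> N"
    then have "w \<in> X \<or> w \<in> Q \<or> w \<in> R" using fib_split[OF v] N by blast
    then show "w \<in> ?K \<union> (X \<inter> fib v) \<union> ?N" using closed[of z w] w N z by blast
  qed
  then have "card N \<le> card (?K \<union> (X \<inter> fib v) \<union> ?N)"
    using fin finite_X N(1) by (intro card_mono) auto
  also have "\<dots> \<le> card ?K + lost_verts v + card ?N"
    unfolding lost_verts_def by (intro order_trans[OF card_Un_le] add_mono card_Un_le) simp
  finally have 1: "card N \<le> card ?K + lost_verts v + card ?N" .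
  have 2: "card ?N \<le> lost_edges {v}"
    unfolding lost_edges_def
  proof (rule card_inj_on_le)
    show "inj_on (\<lambda>w. {z, w}) ?N" by (auto simp: inj_on_def doubleton_eq_iff)
    show "(\<lambda>w. {z, w}) ` ?N \<subseteq> {f \<in> Y. \<pi> ` f = {v}}"
      using N(3) z proj_fib[OF v] by auto
  qed (use finite_Y in auto)
  moreover have "Suc (card ?K) = card (Q \<inter> fib v)"
    using card_Suc_Diff1[OF fin z] .
  ultimately show ?thesis using 1 N(2) by linarith
qed

definition mixed :: "'b \<Rightarrow> bool" where
  "mixed v \<longleftrightarrow> v \<in> verts B \<and> Q \<inter> fib v \<noteq> {} \<and> R \<inter> fib v \<noteq> {}"

lemma mixed_fib:
  assumes "mixed v" "lost_verts v \<le> p"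
  shows "p + a + 1 \<le> lost_verts v + lost_edges {v}"
proof (rule ccontr)
  assume less: "\<not> ?thesis"
  have v: "v \<in> verts B" using assms(1) by (simp add: mixed_def)
  let ?G = "SGraph (fib v) {e \<in> E. e \<subseteq> fib v}"
  let ?X = "X \<inter> fib v" and ?Y = "{f \<in> Y. \<pi> ` f = {v}}"
  have "resilient ?G (lost_verts v) (a + (p - lost_verts v))"
    using resilient_trade_add[OF simple_fib, of v "lost_verts v" "p - lost_verts v" a] resilient_fib[OF v] assms(2)
    by simp
  then have c: "connected_graph (delete ?G ?X ?Y)"
    by (rule resilientD) (use less assms(2) finite_X finite_Y in \<open>auto simp: lost_verts_def lost_edges_def\<close>)
  obtain z w where zw: "z \<in> Q \<inter> fib v" "w \<in> R \<inter> fib v" "{z, w} \<in> edges ?G" "{z, w} \<notin> ?Y"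
  proof (rule connected_delete_crossing[OF c, of "Q \<inter> fib v" "R \<inter> fib v"])
    show "Q \<inter> fib v \<union> R \<inter> fib v = verts ?G - ?X" using fib_split[OF v] by auto
  qed (use assms(1) disj in \<open>auto simp: mixed_def\<close>)
  then have "{z, w} \<in> Y" using closed by auto
  then show False using zw proj_fib[OF v] by auto
qed

lemma mixed_pos:
  assumes "mixed v"
  shows "1 \<le> lost_verts v + lost_edges {v}"
  using mixed_fib[OF assms] by (cases "lost_verts v \<le> p") auto

lemma count_other_side:
  assumes "{u, v} \<in> edges B" "Q \<inter> fib v \<noteq> {}" "Q \<inter> fib u = {}"
  shows "1 \<le> lost_verts u + lost_edges {v, u}"
  using matched_count[OF assms(1) order_refl assms(3)] assms(2)
  by (metis One_nat_def Suc_leI card_gt_0_iff le_trans)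

text \<open>A vertex of a side with \<open>k\<close> vertices, all in one fibre, loses at least \<open>p + a + 2 - k\<close> neighbours
  in the fibre, and each of the \<open>k\<close> vertices loses all its \<open>r + b + 1\<close> neighbours in other fibres.\<close>

lemma side_not_in_fibre:
  assumes res: "resilient B r b" and v: "v \<in> verts B"
    and Q: "Q \<noteq> {}" "Q \<subseteq> fib v"
    and card: "card X + card Y \<le> p + a + r + b + 1"
  shows False
proof -
  obtain N where N: "finite N" "card N = r + b + 1" "N \<subseteq> verts B" "v \<notin> N"
    "\<And>u. u \<in> N \<Longrightarrow> {v, u} \<in> edges B"
    by (rule resilient_degree[OF simple_base res v]) blast
  have Qv: "Q \<inter> fib v = Q" using Q by blast
  have cnt: "finite Q \<and> card Q \<le> lost_verts u + lost_edges {v, u}" if "u \<in> N" for u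
    using matched_count[of u v Q] N(5)[OF that] edge_base[of v u] fib_disjoint[of u v] Q
    by (auto simp: insert_commute)
  obtain u where "u \<in> N" using N(2) by fastforce
  then have fin: "finite Q" using cnt by blast
  obtain z where z: "z \<in> Q" using Q by blast
  have k: "1 \<le> card Q" using fin Q by (simp add: Suc_leI card_gt_0_iff)
  have 1: "p + a + 2 \<le> card Q + lost_verts v + lost_edges {v}"
    using fib_boundary[OF v, of z] z Qv fin by simp
  have "(r + b + 1) * card Q = (\<Sum>u\<in>N. card Q)" using N(2) by simp
  also have "\<dots> \<le> (\<Sum>u\<in>N. lost_verts u + lost_edges {u} + lost_edges {v, u})"
    using cnt by (intro sum_mono) fastforce
  finally have "lost_verts v + lost_edges {v} + (r + b + 1) * card Q \<le> p + a + r + b + 1"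
    using star_sum[OF N(1,3) v N(4)] card by linarith
  \<comment> \<open>Combined with \<open>1\<close>, the single \<open>card Q\<close> cancels,
    leaving \<open>p + a + 2 + (r + b) * card Q\<close> within the bound
    \<open>p + a + r + b + 1\<close>, which is impossible for \<open>card Q\<close> at least
    1.\<close>
  moreover have "(r + b + 1) * card Q = (r + b) * card Q + card Q" by (simp add: algebra_simps)
  moreover have "r + b \<le> (r + b) * card Q" using k by simp
  ultimately show False using 1 by linarith
qed

text \<open>Every neighbour of a mixed base vertex is itself mixed or lies on one side; either way it
  accounts for a deleted element of its own, on top of those separating the mixed fibre.\<close>

lemma mixed_many_vertices:
  assumes res: "resilient B r b" and mix: "mixed v"
    and card: "card X + card Y \<le> p + a + r + b + 1"
  shows "p + 1 \<le> lost_verts v"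
proof (rule ccontr)
  assume "\<not> ?thesis"
  then have 1: "p + a + 1 \<le> lost_verts v + lost_edges {v}" using mixed_fib[OF mix] by simp
  have v: "v \<in> verts B" "Q \<inter> fib v \<noteq> {}" "R \<inter> fib v \<noteq> {}" using mix by (auto simp: mixed_def)
  interpret flip: separated_fibration E fib \<pi> B p a X Y R Q by (rule flipped)
  obtain N where N: "finite N" "card N = r + b + 1" "N \<subseteq> verts B" "v \<notin> N"
    "\<And>u. u \<in> N \<Longrightarrow> {v, u} \<in> edges B"
    by (rule resilient_degree[OF simple_base res v(1)]) blast
  have "1 \<le> lost_verts u + lost_edges {u} + lost_edges {v, u}" if "u \<in> N" for u
  proof -
    have e: "{u, v} \<in> edges B" using N(5)[OF that] by (simp add: insert_commute)
    consider "mixed u" | "Q \<inter> fib u = {}" | "R \<inter> fib u = {}"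
      using edge_base[OF e] by (auto simp: mixed_def)
    then show ?thesis
    proof cases
      case 1 then show ?thesis using mixed_pos[of u] by simp
    next
      case 2 then show ?thesis using count_other_side[OF e v(2)] by simp
    next
      case 3 then show ?thesis using flip.count_other_side[OF e v(3)] by simp
    qed
  qed
  then have "(\<Sum>u\<in>N. 1) \<le> (\<Sum>u\<in>N. lost_verts u + lost_edges {u} + lost_edges {v, u})" by (rule sum_mono)
  then show False using star_sum[OF N(1,3) v(1) N(4)] card 1 N(2) by simp
qed

text \<open>Each vertex of \<open>fib u\<close> is deleted or in \<open>Q\<close>, and in the latter
  case the matching towards \<open>fib w\<close> forces a deletion of its own. So the at least
  \<open>p + a + 2\<close> vertices of \<open>fib u\<close> are all paid for.\<close>

lemma count_across:
  assumes uw: "{u, w} \<in> edges B" and u: "R \<inter> fib u = {}" and w: "Q \<inter> fib w = {}"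
  shows "p + a + 2 \<le> card X + lost_edges {u, w}"
proof -
  have V: "u \<in> verts B" "w \<in> verts B" "u \<noteq> w" using edge_base[OF uw] by auto
  have wu: "{w, u} \<in> edges B" using uw by (simp add: insert_commute)
  note K = matched_count[OF wu order_refl w]
  have fu: "fib u = (Q \<inter> fib u) \<union> (X \<inter> fib u)" using fib_split[OF V(1)] u by blast
  then have fin: "finite (fib u)" using K(1) finite_X by (metis finite_Int finite_UnI)
  have "p + a + 2 \<le> card (fib u)" by (rule card_fib[OF V(1) fin])
  also have "\<dots> \<le> card (Q \<inter> fib u) + lost_verts u"
    unfolding lost_verts_def by (subst fu) (rule card_Un_le)
  also have "\<dots> \<le> lost_verts u + lost_verts w + lost_edges {u, w}" using K(2) by simp
  also have "\<dots> \<le> card X + lost_edges {u, w}"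
    using sum_lost_verts[of "{u, w}"] V by simp
  finally show ?thesis .
qed

lemma side_in_fibre: "z \<in> Q \<Longrightarrow> \<exists>v\<in>verts B. z \<in> fib v"
  using union by (auto simp: total_def)

section \<open>Separations in the case \<open>r = 0\<close>\<close>

lemma cut_bound:
  assumes "finite D" "card D = b + 1" "\<And>e. e \<in> D \<Longrightarrow> k \<le> lost_edges e"
  shows "(b + 1) * k \<le> (\<Sum>e\<in>D. lost_edges e)"
  using sum_bounded_below[of D k lost_edges] assms by simp

text \<open>Without mixed fibres, a base edge leaving \<open>?S\<close> joins a fibre without
  \<open>R\<close> to one without \<open>Q\<close>, which costs \<open>a + 1\<close> deleted edges
  when at most \<open>p + 1\<close> vertices are deleted. A cut with \<open>b + 1\<close> such edges
  needs \<open>(b + 1) * (a + 1)\<close> deletions, more than \<open>a + b\<close>.\<close>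

lemma trivial_if_none_mixed:
  assumes res: "resilient B 0 b" and cX: "card X \<le> p + 1" and cY: "card Y \<le> a + b"
    and none: "\<And>v. \<not> mixed v"
  shows "Q = {} \<or> R = {}"
proof (rule ccontr)
  assume ne: "\<not> ?thesis"
  interpret flip: separated_fibration E fib \<pi> B p a X Y R Q by (rule flipped)
  let ?S = "{v \<in> verts B. Q \<inter> fib v \<noteq> {}}"
  have S: "?S \<subseteq> verts B" by blast
  have S1: "?S \<noteq> {}" using ne side_in_fibre by blast
  have S2: "?S \<noteq> verts B" using ne flip.side_in_fibre none unfolding mixed_def by blast
  obtain D where D: "finite D" "card D = b + 1" "D \<subseteq> edges B"
    "\<And>e. e \<in> D \<Longrightarrow> \<exists>u\<in>?S. \<exists>w\<in>verts B - ?S. e = {u, w}"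
    by (rule resilient_cut[OF res S S1 S2]) blast
  have pos: "a + 1 \<le> lost_edges e" if e: "e \<in> D" for e
  proof -
    obtain u w where uw: "u \<in> ?S" "w \<in> verts B - ?S" "e = {u, w}" using D(4)[OF e] by blast
    then have "R \<inter> fib u = {}" "Q \<inter> fib w = {}" using none[of u] by (auto simp: mixed_def)
    then show ?thesis using count_across[of u w] D(3) e uw(3) cX by auto
  qed
  have "(b + 1) * (a + 1) \<le> card Y"
    using order_trans[OF cut_bound[OF D(1,2) pos] sum_lost_edges[OF D(1)]] .
  then show False using cY by simp
qed

text \<open>All deleted vertices lie over \<open>v\<close>. The other base vertices split into \<open>S\<close> (over which everything is
  in \<open>Q\<close>) and \<open>T\<close> (everything in \<open>R\<close>); the cuts of \<open>B\<close> around \<open>S\<close> and around \<open>T\<close> have \<open>b + 1\<close> edges each, and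
  over all these edges too many edges would have to be deleted.\<close>

lemma trivial_if_mixed:
  assumes res: "resilient B 0 b" and cX: "card X \<le> p + 1" and cY: "card Y \<le> a + b"
    and mix: "mixed v"
  shows False
proof -
  interpret flip: separated_fibration E fib \<pi> B p a X Y R Q by (rule flipped)
  have card: "card X + card Y \<le> p + a + 0 + b + 1" using cX cY by simp
  have v: "v \<in> verts B" "Q \<inter> fib v \<noteq> {}" "R \<inter> fib v \<noteq> {}" using mix by (auto simp: mixed_def)
  have xv: "p + 1 \<le> lost_verts v" by (rule mixed_many_vertices[OF res mix card])
  have xv': "lost_verts v \<le> p + 1"
    using sum_lost_verts[of "{v}"] v cX by simp
  have x0: "lost_verts u = 0" if "u \<in> verts B" "u \<noteq> v" for u
    using sum_lost_verts[of "{u, v}"] that v xv cX by simp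
  \<comment> \<open>The fibre over \<open>v\<close> uses up the whole allowance of
    \<open>p + 1\<close> vertices, so no other fibre loses the number that being mixed
    requires.\<close>
  have nomix: "\<not> mixed u" if "u \<in> verts B" "u \<noteq> v" for u
    using mixed_many_vertices[OF res _ card, of u] x0[OF that] by auto
  define S where "S = {u \<in> verts B - {v}. R \<inter> fib u = {}}"
  define T where "T = {u \<in> verts B - {v}. Q \<inter> fib u = {}}"
  have cover: "verts B = insert v (S \<union> T)"
    using nomix v(1) by (auto simp: S_def T_def mixed_def)
  have ST: "S \<inter> T = {}"
  proof (rule ccontr)
    assume "S \<inter> T \<noteq> {}"
    then obtain u where u: "u \<in> verts B" "u \<noteq> v" "Q \<inter> fib u = {}" "R \<inter> fib u = {}"
      by (auto simp: S_def T_def)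
    then have sub: "fib u \<subseteq> X" using fib_split[OF u(1)] by blast
    then have "finite (fib u)" using finite_X finite_subset by blast
    then have "p + a + 2 \<le> lost_verts u"
      using card_fib[OF u(1)] sub by (simp add: lost_verts_def Int_absorb1)
    then show False using x0[OF u(1,2)] by simp
  qed
  have "S \<noteq> {}"
  proof
    assume "S = {}"
    have "Q \<subseteq> fib v"
    proof
      fix z assume z: "z \<in> Q"
      then obtain u where u: "u \<in> verts B" "z \<in> fib u" using side_in_fibre by blast
      then have "u \<notin> T" using z by (auto simp: T_def)
      then have "u = v" using cover u(1) \<open>S = {}\<close> by auto
      then show "z \<in> fib v" using u by simp
    qed
    then show False using side_not_in_fibre[OF res v(1) _ _ card] v by blast
  qed
  have "T \<noteq> {}"
  proof
    assume "T = {}"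
    have "R \<subseteq> fib v"
    proof
      fix z assume z: "z \<in> R"
      then obtain u where u: "u \<in> verts B" "z \<in> fib u" using flip.side_in_fibre by blast
      then have "u \<notin> S" using z by (auto simp: S_def)
      then have "u = v" using cover u(1) \<open>T = {}\<close> by auto
      then show "z \<in> fib v" using u by simp
    qed
    then show False using flip.side_not_in_fibre[OF res v(1) _ _ card] v by blast
  qed
  have sub: "S \<subseteq> verts B" "T \<subseteq> verts B" "S \<noteq> verts B" "T \<noteq> verts B"
    using v(1) by (auto simp: S_def T_def)
  obtain DS where DS: "finite DS" "card DS = b + 1" "DS \<subseteq> edges B"
    "\<And>e. e \<in> DS \<Longrightarrow> \<exists>u\<in>S. \<exists>w\<in>verts B - S. e = {u, w}"
    by (rule resilient_cut[OF res sub(1) \<open>S \<noteq> {}\<close> sub(3)]) blast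
  obtain DT where DT: "finite DT" "card DT = b + 1" "DT \<subseteq> edges B"
    "\<And>e. e \<in> DT \<Longrightarrow> \<exists>u\<in>T. \<exists>w\<in>verts B - T. e = {u, w}"
    by (rule resilient_cut[OF res sub(2) \<open>T \<noteq> {}\<close> sub(4)]) blast
  have across: "a + 1 \<le> lost_edges {u, w}" if "u \<in> S" "w \<in> T" "{u, w} \<in> edges B" for u w
    using count_across[OF that(3)] that(1,2) cX by (auto simp: S_def T_def)
  have vT: "finite (Q \<inter> fib v) \<and> card (Q \<inter> fib v) \<le> lost_edges {u, v}"
    if "u \<in> T" "{u, v} \<in> edges B" for u
    using matched_count[OF that(2) order_refl] that(1) x0[of u]
    by (auto simp: T_def insert_commute)
  have vS: "finite (R \<inter> fib v) \<and> card (R \<inter> fib v) \<le> lost_edges {u, v}"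
    if "u \<in> S" "{u, v} \<in> edges B" for u
    using flip.matched_count[OF that(2) order_refl] that(1) x0[of u]
    by (auto simp: S_def insert_commute)
  show False
  proof (cases "\<exists>u\<in>S. \<exists>w\<in>T. {u, w} \<in> edges B")
    case True
    then obtain u w where uw: "u \<in> S" "w \<in> T" "{u, w} \<in> edges B" by blast
    \<comment> \<open>This edge costs \<open>a + 1\<close> deletions, and whether or not it belongs
      to \<open>DT\<close>, at least \<open>b\<close> other edges of \<open>DT\<close> cost one or
      more each.\<close>
    let ?e = "{u, w}"
    have pos: "1 \<le> lost_edges e" if e: "e \<in> DT" for e
    proof -
      obtain t s where ts: "t \<in> T" "s \<in> verts B - T" "e = {t, s}" using DT(4)[OF e] by blast
      have eB: "{t, s} \<in> edges B" using DT(3) e ts(3) by blast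
      show ?thesis
      proof (cases "s = v")
        case True
        then have "finite (Q \<inter> fib v)" "card (Q \<inter> fib v) \<le> lost_edges e"
          using vT[OF ts(1)] eB ts(3) by auto
        then show ?thesis using v(2) by (metis One_nat_def Suc_leI card_gt_0_iff le_trans)
      next
        case False
        then have "s \<in> S" using ts(2) cover by blast
        then show ?thesis using across[of s t] ts eB by (simp add: insert_commute)
      qed
    qed
    have "b \<le> card (DT - {?e})" using DT(1,2) by (simp add: card_Diff_singleton_if)
    also have "\<dots> \<le> (\<Sum>e\<in>DT - {?e}. lost_edges e)"
      using sum_mono[of "DT - {?e}" "\<lambda>_. 1" lost_edges] pos by simp
    finally have "a + 1 + b \<le> (\<Sum>e\<in>insert ?e (DT - {?e}). lost_edges e)"
      using DT(1) across[OF uw] by (subst sum.insert) auto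
    also have "\<dots> \<le> card Y" using DT(1) by (intro sum_lost_edges) simp
    finally show False using cY by simp
  next
    case False
    \<comment> \<open>All chosen cut edges now end in \<open>v\<close>, so each edge of
      \<open>DT\<close> costs \<open>card (Q \<inter> fib v)\<close> and each edge of
      \<open>DS\<close> costs \<open>card (R \<inter> fib v)\<close>. These numbers add up to at
      least \<open>a + 1\<close>, as at most \<open>p + 1\<close> of at least
      \<open>p + a + 2\<close> vertices over \<open>v\<close> are deleted.\<close>
    have DTv: "\<exists>u\<in>T. e = {u, v} \<and> {u, v} \<in> edges B" if e: "e \<in> DT" for e
    proof -
      obtain t s where ts: "t \<in> T" "s \<in> verts B - T" "e = {t, s}" using DT(4)[OF e] by blast
      then have "s = v" using False cover DT(3) e by (auto simp: insert_commute)
      then show ?thesis using ts DT(3) e by blast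
    qed
    have DSv: "\<exists>u\<in>S. e = {u, v} \<and> {u, v} \<in> edges B" if e: "e \<in> DS" for e
    proof -
      obtain s t where ts: "s \<in> S" "t \<in> verts B - S" "e = {s, t}" using DS(4)[OF e] by blast
      then have "t = v" using False cover DS(3) e by auto
      then show ?thesis using ts DS(3) e by blast
    qed
    have "DS \<inter> DT = {}" using DSv DTv ST by (fastforce simp: doubleton_eq_iff)
    then have "(\<Sum>e\<in>DT. lost_edges e) + (\<Sum>e\<in>DS. lost_edges e) = (\<Sum>e\<in>DT \<union> DS. lost_edges e)"
      using DS(1) DT(1) by (intro sum.union_disjoint[symmetric]) auto
    also have "\<dots> \<le> card Y" using DS(1) DT(1) by (intro sum_lost_edges) simp
    finally have "(\<Sum>e\<in>DT. lost_edges e) + (\<Sum>e\<in>DS. lost_edges e) \<le> card Y" .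
    moreover have "card (Q \<inter> fib v) \<le> lost_edges e" if "e \<in> DT" for e
      using DTv[OF that] vT by blast
    then have "(b + 1) * card (Q \<inter> fib v) \<le> (\<Sum>e\<in>DT. lost_edges e)"
      by (rule cut_bound[OF DT(1,2)])
    moreover have "card (R \<inter> fib v) \<le> lost_edges e" if "e \<in> DS" for e
      using DSv[OF that] vS by blast
    then have "(b + 1) * card (R \<inter> fib v) \<le> (\<Sum>e\<in>DS. lost_edges e)"
      by (rule cut_bound[OF DS(1,2)])
    ultimately have 1: "(b + 1) * card (Q \<inter> fib v) + (b + 1) * card (R \<inter> fib v) \<le> card Y"
      by linarith
    obtain e e' where "e \<in> DT" "e' \<in> DS" using DT(2) DS(2) by fastforce
    then have fin: "finite (Q \<inter> fib v)" "finite (R \<inter> fib v)" using DTv vT DSv vS by blast+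
    have fv: "fib v = (Q \<inter> fib v) \<union> (R \<inter> fib v) \<union> (X \<inter> fib v)"
      using fib_split[OF v(1)] by blast
    then have "finite (fib v)" using fin finite_X by (metis finite_Int finite_UnI)
    then have "p + a + 2 \<le> card (fib v)" by (rule card_fib[OF v(1)])
    also have "\<dots> \<le> card (Q \<inter> fib v) + card (R \<inter> fib v) + lost_verts v"
      unfolding lost_verts_def by (subst fv) (intro order_trans[OF card_Un_le] add_mono card_Un_le order_refl)
    finally have "a + 1 \<le> card (Q \<inter> fib v) + card (R \<inter> fib v)" using xv' by simp
    then have "(b + 1) * (a + 1) \<le> (b + 1) * (card (Q \<inter> fib v) + card (R \<inter> fib v))"
      by (rule mult_le_mono2)
    also have "\<dots> \<le> card Y" using 1 by (simp add: algebra_simps)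
    finally show False using cY by simp
  qed
qed

end

text \<open>A base vertex with deleted vertices over it can be removed along with its fibre, which lowers \<open>r\<close>
  by one; the vertices of that fibre are reattached by \<open>side_not_in_fibre\<close>.\<close>

lemma separated_fibration_trivial:
  assumes "separated_fibration E fib \<pi> B p a X Y Q R"
    and "resilient B r b" and "card X \<le> p + r + 1" and "card Y \<le> a + b"
  shows "Q = {} \<or> R = {}"
  using assms
proof (induction r arbitrary: B X Q R)
  case 0
  then interpret separated_fibration E fib \<pi> B p a X Y Q R by simp
  show ?case using trivial_if_none_mixed[OF 0(2)] trivial_if_mixed[OF 0(2)] 0(3,4) by auto
next
  case (Suc r)
  interpret separated_fibration E fib \<pi> B p a X Y Q R by fact
  interpret flip: separated_fibration E fib \<pi> B p a X Y R Q by (rule flipped)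
  show ?case
  proof (cases "\<exists>v\<in>verts B. X \<inter> fib v \<noteq> {}")
    case True
    then obtain v where v: "v \<in> verts B" "X \<inter> fib v \<noteq> {}" by blast
    let ?B = "delete B {v} {}"
    have sub: "edges ?B \<subseteq> edges B" "verts ?B = verts B - {v}" by (auto simp: delete_def)
    have simple: "simple_graph ?B"
      using simple_base by (auto simp: simple_graph_def delete_def nsets_def)
    interpret small: fibration E fib \<pi> ?B p a
      using card_edge simple proj_fib resilient_fib matching sub by unfold_locales blast+
    have total: "small.total = total - fib v"
      using v(1) fib_disjoint[OF _ v(1)] by (auto simp: total_def small.total_def sub(2))
    have "separated_fibration E fib \<pi> ?B p a (X - fib v) Y (Q - fib v) (R - fib v)"
      using finite_X finite_Y union disj closed total by unfold_locales auto
    moreover have "card (X - fib v) < card X"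
      using v(2) finite_X by (intro psubset_card_mono) auto
    then have "card (X - fib v) \<le> p + r + 1" using Suc.prems(3) by simp
    ultimately have "Q - fib v = {} \<or> R - fib v = {}"
      using Suc.IH[of ?B] resilient_delete_vertex[OF Suc.prems(2)] Suc.prems(4) by blast
    moreover have "card X + card Y \<le> p + a + Suc r + b + 1" using Suc.prems by simp
    ultimately show ?thesis
      using side_not_in_fibre[OF Suc.prems(2) v(1)] flip.side_not_in_fibre[OF Suc.prems(2) v(1)]
      by blast
  next
    case False
    \<comment> \<open>No deleted vertex lies in \<open>total\<close>, so the empty set can replace
      \<open>X\<close>, and the induction hypothesis applies with the same \<open>B\<close>.\<close>
    then have "total - X = total - {}" by (auto simp: total_def)
    then have "separated_fibration E fib \<pi> B p a {} Y Q R"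
      using finite_Y union disj closed by unfold_locales auto
    then show ?thesis
      using Suc.IH[of B "{}" Q R] resilient_mono[OF Suc.prems(2), of r b] Suc.prems(4) by simp
  qed
qed

section \<open>Resilience of the total graph\<close>

context fibration
begin

text \<open>A base vertex and \<open>r + b + 1\<close> of its neighbours carry disjoint fibres of at
  least \<open>p + a + 2\<close> vertices each, too many to be covered by \<open>X\<close> and one
  further vertex.\<close>

lemma total_not_singleton:
  assumes res: "resilient B r b" and X: "finite X" "card X \<le> p + r + 1"
  shows "\<not> total - X \<subseteq> {z}"
proof
  assume sub: "total - X \<subseteq> {z}"
  obtain v where v: "v \<in> verts B"
    using connected_delete_two_verts[OF resilientD[OF res, of "{}" "{}"]] by auto
  obtain N where N: "finite N" "card N = r + b + 1" "N \<subseteq> verts B" "v \<notin> N"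
    by (rule resilient_degree[OF simple_base res v])
  let ?N = "insert v N"
  have NB: "?N \<subseteq> verts B" using N v by blast
  have fibX: "fib u \<subseteq> insert z X" if "u \<in> ?N" for u
    using sub that NB by (auto simp: total_def)
  then have fin: "finite (fib u)" if "u \<in> ?N" for u
    using that X(1) by (meson finite_insert finite_subset)
  have "(r + b + 2) * (p + a + 2) = (\<Sum>u\<in>?N. p + a + 2)" using N by simp
  also have "\<dots> \<le> (\<Sum>u\<in>?N. card (fib u))"
    using NB fin by (intro sum_mono card_fib) auto
  also have "\<dots> = card (\<Union>u\<in>?N. fib u)"
    using N(1) NB fin fib_disjoint by (intro card_UN_disjoint[symmetric]) blast+
  also have "\<dots> \<le> card (insert z X)"
    using fibX X(1) by (intro card_mono) auto
  also have "\<dots> \<le> p + r + 2" using X by (simp add: card_insert_if)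
  finally show False by (simp add: algebra_simps)
qed

lemma resilient_total:
  assumes res: "resilient B r b"
  shows "resilient (SGraph total E) (p + r + 1) (a + b)"
  unfolding resilient_def
proof (intro allI impI, elim conjE)
  fix X :: "'g set" and Y :: "'g set set"
  assume X: "finite X" "card X \<le> p + r + 1" and Y: "finite Y" "card Y \<le> a + b"
  show "connected_graph (delete (SGraph total E) X Y)"
  proof (rule connected_deleteI)
    show "\<not> verts (SGraph total E) - X \<subseteq> {z}" for z
      using total_not_singleton[OF res X] by simp
    fix Q R assume QR: "Q \<union> R = verts (SGraph total E) - X" "Q \<inter> R = {}" "Q \<noteq> {}" "R \<noteq> {}"
    show "\<exists>z\<in>Q. \<exists>w\<in>R. {z, w} \<in> edges (SGraph total E) \<and> {z, w} \<notin> Y"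
    proof (rule ccontr)
      assume "\<not> ?thesis"
      then have "separated_fibration E fib \<pi> B p a X Y Q R"
        using X Y QR by unfold_locales auto
      from separated_fibration_trivial[OF this res X(2) Y(2)] QR show False by blast
    qed
  qed
qed

end

section \<open>Cartesian bundles\<close>

lemma bundle_map_verts:
  assumes "bundle_map h G F B" "x \<in> verts G"
  obtains v where "v \<in> verts B" "h (Inl x) = Inl v"
  using assms by (auto simp: bundle_map_def graph_map_def)

text \<open>The graph on \<open>fib\<close> has all edges of \<open>G\<close> inside
  \<open>fib\<close>, while the preimage of \<open>v\<close> has the edges sent to \<open>v\<close>.
  Including the latter among the former suffices for \<open>resilient_transfer\<close>.\<close>

lemma bundle_map_resilient_fibre:
  assumes h: "bundle_map h G F B" and G: "simple_graph G" and v: "v \<in> verts B"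
    and res: "resilient F p a" and fib: "fib = {x \<in> verts G. h (Inl x) = Inl v}"
  shows "resilient (SGraph fib {e \<in> edges G. e \<subseteq> fib}) p a"
proof -
  let ?H = "preimage_graph h G (vertex_graph v)"
  obtain \<phi> where iso: "graph_iso \<phi> ?H F" using h v by (auto simp: bundle_map_def)
  have vH: "verts ?H = fib"
    by (auto simp: fib preimage_graph_def elems_def vertex_graph_def)
  have gm: "graph_map h G B" using h by (simp add: bundle_map_def)
  have eH: "edges ?H \<subseteq> {e \<in> edges G. e \<subseteq> fib}"
  proof
    fix e assume "e \<in> edges ?H"
    then have e: "e \<in> edges G" "h (Inr e) = Inl v"
      by (auto simp: preimage_graph_def elems_def vertex_graph_def)
    then have "e \<subseteq> verts G" using G by (auto simp: simple_graph_def nsets_def)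
    moreover have "\<forall>x\<in>e. h (Inl x) = Inl v" using gm e by (auto simp: graph_map_def)
    ultimately show "e \<in> {e \<in> edges G. e \<subseteq> fib}" using e by (auto simp: fib)
  qed
  show ?thesis
  proof (rule resilient_transfer[OF res])
    show "bij_betw \<phi> (verts (SGraph fib {e \<in> edges G. e \<subseteq> fib})) (verts F)"
      using iso vH by (simp add: graph_iso_def)
    fix x y
    assume "x \<in> verts (SGraph fib {e \<in> edges G. e \<subseteq> fib})"
      "y \<in> verts (SGraph fib {e \<in> edges G. e \<subseteq> fib})" "{\<phi> x, \<phi> y} \<in> edges F"
    then have "{x, y} \<in> edges ?H" using iso vH by (simp add: graph_iso_def)
    then show "{x, y} \<in> edges (SGraph fib {e \<in> edges G. e \<subseteq> fib})" using eH by auto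
  qed
qed

lemma bundle_map_matching:
  assumes h: "bundle_map h G F B" and uv: "{u, v} \<in> edges B"
    and fib: "\<And>w. fib w = {x \<in> verts G. h (Inl x) = Inl w}"
  shows "\<exists>m. inj_on m (fib u) \<and> m ` fib u \<subseteq> fib v \<and> (\<forall>z\<in>fib u. {z, m z} \<in> edges G)"
proof -
  let ?H = "preimage_graph h G (edge_graph {u, v})"
  let ?P = "cart_prod F (edge_graph {u, v})"
  obtain \<psi> where iso: "graph_iso \<psi> ?H ?P" and proj: "\<forall>x\<in>verts ?H. h (Inl x) = Inl (snd (\<psi> x))"
    using h uv by (auto simp: bundle_map_def Let_def)
  have gm: "graph_map h G B" using h by (simp add: bundle_map_def)
  then have "x \<in> verts G \<Longrightarrow> h (Inl x) \<noteq> Inr e" for x e by (auto simp: graph_map_def)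
  then have vH: "verts ?H = fib u \<union> fib v"
    by (auto simp: fib preimage_graph_def elems_def edge_graph_def)
  have bij: "bij_betw \<psi> (verts ?H) (verts ?P)"
    and edges: "\<And>x y. x \<in> verts ?H \<Longrightarrow> y \<in> verts ?H \<Longrightarrow> {x, y} \<in> edges ?H \<longleftrightarrow> {\<psi> x, \<psi> y} \<in> edges ?P"
    using iso by (auto simp: graph_iso_def)
  \<comment> \<open>The step along the \<open>K2\<close> factor: the first coordinate is kept and
    the second becomes \<open>v\<close>. It leads from \<open>fib u\<close> to \<open>fib v\<close>
    because \<open>snd (\<psi> x)\<close> is the projection of \<open>x\<close>.\<close>
  define m where "m x = inv_into (verts ?H) \<psi> (fst (\<psi> x), v)" for x
  have snd_\<psi>: "snd (\<psi> x) = u" if "x \<in> fib u" for x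
    using bspec[OF proj, of x] that vH by (simp add: fib)
  have fst_\<psi>: "fst (\<psi> x) \<in> verts F" if "x \<in> fib u" for x
  proof -
    have "\<psi> x \<in> verts ?P" using bij that vH by (auto dest: bij_betwE)
    then show ?thesis by (auto simp: cart_prod_def)
  qed
  have m: "m x \<in> verts ?H" "\<psi> (m x) = (fst (\<psi> x), v)" if "x \<in> fib u" for x
  proof -
    have "(fst (\<psi> x), v) \<in> verts ?P"
      using fst_\<psi>[OF that] by (simp add: cart_prod_def edge_graph_def)
    then have "(fst (\<psi> x), v) \<in> \<psi> ` verts ?H" using bij by (simp add: bij_betw_def)
    then show "m x \<in> verts ?H" "\<psi> (m x) = (fst (\<psi> x), v)"
      unfolding m_def by (rule inv_into_into, rule f_inv_into_f)
  qed
  have "inj_on m (fib u)"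
  proof (rule inj_onI)
    fix x y assume xy: "x \<in> fib u" "y \<in> fib u" "m x = m y"
    then have "fst (\<psi> x) = fst (\<psi> y)" using m(2) by (metis Pair_inject)
    then have "\<psi> x = \<psi> y" using snd_\<psi> xy by (simp add: prod_eq_iff)
    then show "x = y" using bij xy vH by (auto simp: bij_betw_def inj_on_def)
  qed
  moreover have "m ` fib u \<subseteq> fib v"
  proof safe
    fix x assume x: "x \<in> fib u"
    then have "h (Inl (m x)) = Inl v" using proj m by fastforce
    moreover have "m x \<in> verts G" using m(1)[OF x] by (simp add: preimage_graph_def)
    ultimately show "m x \<in> fib v" by (simp add: fib)
  qed
  moreover have "{x, m x} \<in> edges G" if x: "x \<in> fib u" for x
  proof -
    have "\<psi> x = (fst (\<psi> x), u)" using snd_\<psi>[OF x] by (simp add: prod_eq_iff)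
    then have "{\<psi> x, \<psi> (m x)} = {(fst (\<psi> x), u), (fst (\<psi> x), v)}" using m(2)[OF x] by simp
    also have "\<dots> \<in> edges ?P"
      using fst_\<psi>[OF x] by (auto simp: cart_prod_def edge_graph_def)
    finally have "{x, m x} \<in> edges ?H" using edges x vH m(1) by blast
    then show ?thesis by (simp add: preimage_graph_def)
  qed
  ultimately show ?thesis by blast
qed

lemma resilient_cartesian_bundle:
  assumes G: "simple_graph G" and B: "simple_graph B" and GFB: "cartesian_bundle G F B"
    and F_res: "resilient F p a" and B_res: "resilient B r b"
  shows "resilient G (p + r + 1) (a + b)"
proof -
  obtain h where h: "bundle_map h G F B" using GFB by (auto simp: cartesian_bundle_def)
  define fib where "fib v = {x \<in> verts G. h (Inl x) = Inl v}" for v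
  interpret fibration "edges G" fib "\<lambda>x. projl (h (Inl x))" B p a
  proof
    show "card e = 2" if "e \<in> edges G" for e
      using G that by (auto simp: simple_graph_def nsets_def)
    show "projl (h (Inl z)) = v" if "z \<in> fib v" for v z
      using that by (simp add: fib_def)
    show "resilient (SGraph (fib v) {e \<in> edges G. e \<subseteq> fib v}) p a" if "v \<in> verts B" for v
      by (rule bundle_map_resilient_fibre[OF h G that F_res fib_def])
    show "\<exists>m. inj_on m (fib u) \<and> m ` fib u \<subseteq> fib v \<and> (\<forall>z\<in>fib u. {z, m z} \<in> edges G)"
      if "{u, v} \<in> edges B" for u v
      by (rule bundle_map_matching[OF h that fib_def])
  qed (rule B)
  have "total = verts G"
    using bundle_map_verts[OF h] by (auto simp: total_def fib_def)
  then have "SGraph total (edges G) = G" by simp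
  then show ?thesis using resilient_total[OF B_res] by simp
qed

theorem theorem4p6:
  fixes G :: "'g sgraph" and F :: "'f sgraph" and B :: "'b sgraph"
    and p\<^sub>F q\<^sub>F p\<^sub>B q\<^sub>B :: nat
  assumes "simple_graph G" and "simple_graph F" and "simple_graph B"
    and "cartesian_bundle G F B"
    and "mixed_connected F p\<^sub>F q\<^sub>F" and "mixed_connected B p\<^sub>B q\<^sub>B"
  shows "mixed_connected G (p\<^sub>F + p\<^sub>B) (q\<^sub>F + q\<^sub>B) \<and>
         (q\<^sub>F > 0 \<and> q\<^sub>B > 0 \<longrightarrow> mixed_connected G (p\<^sub>F + p\<^sub>B + 1) (q\<^sub>F + q\<^sub>B - 1))"
proof -
  note product = resilient_cartesian_bundle[OF assms(1,3,4)]
  note F = assms(5)[unfolded mixed_connected_iff_resilient]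
    and B = assms(6)[unfolded mixed_connected_iff_resilient]
  \<comment> \<open>If both edge parameters are positive, the product bound is (2), and trading one
    vertex for an edge gives (1). Each vanishing edge parameter lowers its vertex parameter by one;
    the extra 1 in \<open>p + r + 1\<close> makes up for one such loss, and if both vanish, the
    other is the shift in \<open>(p, 0)\<close>-connectivity of \<open>G\<close> itself.\<close>
  show ?thesis
  proof (cases "q\<^sub>F > 0 \<and> q\<^sub>B > 0")
    case True
    then obtain c d where cd: "q\<^sub>F = Suc c" "q\<^sub>B = Suc d" by (metis gr0_conv_Suc)
    have "resilient G (Suc (p\<^sub>F + p\<^sub>B)) (c + d)"
      using product[of p\<^sub>F c p\<^sub>B d] F B cd by simp
    then show ?thesis
      using resilient_trade[OF assms(1)] cd by (simp add: mixed_connected_iff_resilient)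
  next
    case False
    then show ?thesis
      using product[of "p\<^sub>F - 1" 0 "p\<^sub>B - 1" 0] product[of "p\<^sub>F - 1" 0 p\<^sub>B "q\<^sub>B - 1"]
        product[of p\<^sub>F "q\<^sub>F - 1" "p\<^sub>B - 1" 0] F B
      by (auto simp: mixed_connected_iff_resilient split: if_splits)
  qed
qed

end
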